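(* Let $\Omega$ be a Hausdorff topological space with Borel $\sigma$-field $\mathfrak{B}$, let $\Theta$ be the set of all probability measures on $(\Omega,\mathfrak{B})$, and let $\Theta_0,\Theta_1\subset\Theta$. Let $X_1,X_2,\ldots$ be i.i.d. with law $P\in\Theta$. Suppose that the hypothesis $H_0:P\in\Theta_0$ and the alternative $H_1:P\in\Theta_1$ are distinguishable. Then $H_0$ and $H_1$ are uniformly discernible; moreover, there exist a sequence of tests $K_n$ uniformly discerning $H_0$ and $H_1$, with associated positive random variable $N$, and constants $t>0$ and $C<\infty$ such that $$\sup_{P\in\Theta_0\cup\Theta_1}E_P[\exp\{tN\}]<C<\infty.$$
   Context: A test based on $n$ observations is a measurable function $K_n=K_n(X_1,\ldots,X_n)$ with values in $[0,1]$, on $\Omega^n$ with the product $\sigma$-field. Put $\alpha(K_n)=\sup_{P\in\Theta_0}E_P[K_n]$ and $\beta(K_n)=\sup_{P\in\Theta_1}E_P[1-K_n]$. $H_0$ and $H_1$ are distinguishable if for every $0<\alpha<1$ there are tests $K_n$, $n=1,2,\ldots$, with $\alpha(K_n)<\alpha$ and $\lim_{n\to\infty}\beta(K_n)=0$. $P$ and $E_P$ also denote probability and expectation for the infinite i.i.d. sequence $X_1,X_2,\ldots$ with marginal law $P$. A positive random variable $N$ (a function of the sequence $X_1,X_2,\ldots$) is uniformly bounded if $\lim_{C\to\infty}\sup_{P\in\Theta_0\cup\Theta_1}P(N>C)=0$. $H_0$ and $H_1$ are uniformly discernible if there are a sequence of tests $K_n=K_n(X_1,\ldots,X_n)$ and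 a uniformly bounded positive random variable $N$ such that $P(K_n=0\text{ for all }n>N)=1$ for all $P\in\Theta_0$ and $P(K_n=1\text{ for all }n>N)=1$ for all $P\in\Theta_1$; in this case one says that the sequence $K_n$ uniformly discerns $H_0$ and $H_1$, and $N$ is the associated random variable. *)

theory Defs
  imports "HOL-Probability.Probability"
begin

text \<open>
  The sequence \<open>X\<^sub>1, X\<^sub>2, \<dots>\<close> is the coordinate process on \<open>nat \<Rightarrow> 'a\<close>, with \<open>X\<^sub>i\<close> the
  coordinate \<open>i - 1\<close>; \<open>\<Omega>\<close> is the type \<open>'a\<close>. Expectations of nonnegative random variables,
  and suprema over sets of measures, are taken in \<^typ>\<open>ennreal\<close>, so that infinite expectations
  count as infinite and the supremum over an empty set of measures is 0.
\<close>

definition all_laws :: "'a::topological_space measure set" where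
  "all_laws = space (prob_algebra borel)"

lemma all_laws_iff: "P \<in> all_laws \<longleftrightarrow> prob_space P \<and> sets P = sets borel"
  by (auto simp: all_laws_def space_prob_algebra)

definition iid :: "'a measure \<Rightarrow> (nat \<Rightarrow> 'a) measure" where
  "iid P = (\<Pi>\<^sub>M i\<in>UNIV. P)"

definition obs :: "nat \<Rightarrow> (nat \<Rightarrow> 'a) \<Rightarrow> nat \<Rightarrow> 'a" where
  "obs n \<omega> = restrict \<omega> {..<n}"

definition expect :: "'a measure \<Rightarrow> ((nat \<Rightarrow> 'a) \<Rightarrow> real) \<Rightarrow> ennreal" where
  "expect P Z = (\<integral>\<^sup>+ \<omega>. ennreal (Z \<omega>) \<partial>iid P)"

text \<open>The \<open>\<sigma>\<close>-field on \<open>\<Omega>\<^sup>n\<close> is the product of the Borel \<open>\<sigma>\<close>-fields, which for general \<open>\<Omega>\<close> may be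
  smaller than the Borel \<open>\<sigma>\<close>-field of the product topology.\<close>

definition is_test :: "nat \<Rightarrow> ((nat \<Rightarrow> 'a::topological_space) \<Rightarrow> real) \<Rightarrow> bool" where
  "is_test n k \<longleftrightarrow>
     k \<in> borel_measurable (\<Pi>\<^sub>M i\<in>{..<n}. (borel :: 'a measure)) \<and>
     (\<forall>x \<in> space (\<Pi>\<^sub>M i\<in>{..<n}. (borel :: 'a measure)). 0 \<le> k x \<and> k x \<le> 1)"

definition err0 :: "'a measure set \<Rightarrow> nat \<Rightarrow> ((nat \<Rightarrow> 'a) \<Rightarrow> real) \<Rightarrow> ennreal" where
  "err0 \<Theta>0 n k = (SUP P\<in>\<Theta>0. expect P (\<lambda>\<omega>. k (obs n \<omega>)))"

definition err1 :: "'a measure set \<Rightarrow> nat \<Rightarrow> ((nat \<Rightarrow> 'a) \<Rightarrow> real) \<Rightarrow> ennreal" where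
  "err1 \<Theta>1 n k = (SUP P\<in>\<Theta>1. expect P (\<lambda>\<omega>. 1 - k (obs n \<omega>)))"

definition distinguishable :: "'a::topological_space measure set \<Rightarrow> 'a measure set \<Rightarrow> bool" where
  "distinguishable \<Theta>0 \<Theta>1 \<longleftrightarrow>
     (\<forall>\<alpha>::real. 0 < \<alpha> \<and> \<alpha> < 1 \<longrightarrow>
        (\<exists>K :: nat \<Rightarrow> (nat \<Rightarrow> 'a) \<Rightarrow> real.
           (\<forall>n\<ge>1. is_test n (K n) \<and> err0 \<Theta>0 n (K n) < ennreal \<alpha>) \<and>
           (\<lambda>n. err1 \<Theta>1 n (K n)) \<longlonglongrightarrow> 0))"

definition positive_rv :: "((nat \<Rightarrow> 'a::topological_space) \<Rightarrow> real) \<Rightarrow> bool" where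
  "positive_rv N \<longleftrightarrow>
     N \<in> borel_measurable (\<Pi>\<^sub>M i\<in>UNIV. (borel :: 'a measure)) \<and> (\<forall>\<omega>. 0 < N \<omega>)"

definition uniformly_bounded ::
  "'a measure set \<Rightarrow> 'a measure set \<Rightarrow> ((nat \<Rightarrow> 'a) \<Rightarrow> real) \<Rightarrow> bool" where
  "uniformly_bounded \<Theta>0 \<Theta>1 N \<longleftrightarrow>
     ((\<lambda>C::real. SUP P\<in>\<Theta>0 \<union> \<Theta>1. emeasure (iid P) {\<omega> \<in> space (iid P). N \<omega> > C}) \<longlongrightarrow> 0) at_top"

definition uniformly_discerns ::
  "'a::topological_space measure set \<Rightarrow> 'a measure set \<Rightarrow>
   (nat \<Rightarrow> (nat \<Rightarrow> 'a) \<Rightarrow> real) \<Rightarrow> ((nat \<Rightarrow> 'a) \<Rightarrow> real) \<Rightarrow> bool" where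
  "uniformly_discerns \<Theta>0 \<Theta>1 K N \<longleftrightarrow>
     (\<forall>n\<ge>1. is_test n (K n)) \<and>
     positive_rv N \<and> uniformly_bounded \<Theta>0 \<Theta>1 N \<and>
     (\<forall>P\<in>\<Theta>0. \<P>(\<omega> in iid P. \<forall>n::nat. real n > N \<omega> \<longrightarrow> K n (obs n \<omega>) = 0) = 1) \<and>
     (\<forall>P\<in>\<Theta>1. \<P>(\<omega> in iid P. \<forall>n::nat. real n > N \<omega> \<longrightarrow> K n (obs n \<omega>) = 1) = 1)"

definition uniformly_discernible ::
  "'a::topological_space measure set \<Rightarrow> 'a measure set \<Rightarrow> bool" where
  "uniformly_discernible \<Theta>0 \<Theta>1 \<longleftrightarrow> (\<exists>K N. uniformly_discerns \<Theta>0 \<Theta>1 K N)"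

end

theory Submission
  imports Defs
begin

text \<open>
  Taking \<open>\<alpha> = 1/4\<close>, distinguishability yields one sample size \<open>m\<close> and one test \<open>a\<close> of \<open>m\<close>
  observations whose two error bounds are both below \<open>1/4\<close>. Cut the observations into disjoint
  blocks of length \<open>m\<close>; the values of \<open>a\<close> on the blocks are i.i.d., and after \<open>l\<close> blocks one
  decides by comparing their sum with \<open>l/2\<close>. A Chernoff bound, uniform in the law, makes the
  probability of a wrong decision after \<open>l\<close> blocks at most \<open>(7/8)\<^sup>l\<close>
  (\<open>majority_error_bound\<close>).

  By the Borel--Cantelli lemma the decisions are eventually all correct. The random variable \<open>N\<close>,
  however, must not refer to the unknown law, so it cannot be defined as the time of the last
  \<^emph>\<open>wrong\<close> decision. It is defined instead through the time \<open>T\<close> of the last \<^emph>\<open>change\<close> of decision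
  (\<open>settling_time\<close>): almost surely the decisions are correct in the long run, hence correct from
  time \<open>T\<close> on, and if \<open>T > 0\<close> then the decision at time \<open>T - 1\<close> is wrong. The second fact gives
  \<open>r\<^bsup>T+1\<^esup> \<le> r + (\<Sum>l. r\<^bsup>l+2\<^esup> 1[wrong at l])\<close>, whose expectation is finite and bounded uniformly
  in the law as soon as \<open>7r/8 < 1\<close>. With \<open>N = m(T + 1)\<close> and \<open>exp (tm) = r\<close> this is the required
  exponential moment, and Markov's inequality turns it into uniform boundedness.
\<close>

section \<open>Independent blocks of observations\<close>

definition block :: "nat \<Rightarrow> nat \<Rightarrow> (nat \<Rightarrow> 'a) \<Rightarrow> nat \<Rightarrow> 'a" where
  "block m j \<omega> = (\<lambda>i\<in>{..<m}. \<omega> (j * m + i))"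

lemma obs_eq_block: "obs m = block m 0"
  by (auto simp: obs_def block_def fun_eq_iff)

lemma block_obs:
  assumes "Suc j * m \<le> n"
  shows "block m j (obs n \<omega>) = block m j \<omega>"
  using assms by (auto simp: obs_def block_def fun_eq_iff)

lemma prob_space_iid: "prob_space P \<Longrightarrow> prob_space (iid P)"
  unfolding iid_def by (intro prob_space_PiM)

lemma sets_iid_cong: "sets P = sets Q \<Longrightarrow> sets (iid P) = sets (\<Pi>\<^sub>M i\<in>UNIV. Q)"
  unfolding iid_def by (intro sets_PiM_cong) auto

lemma measurable_block:
  assumes "{j * m..<Suc j * m} \<subseteq> I"
  shows "block m j \<in> (\<Pi>\<^sub>M i\<in>I. P) \<rightarrow>\<^sub>M (\<Pi>\<^sub>M i\<in>{..<m}. P)"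
  unfolding block_def using assms by (intro measurable_restrict measurable_component_singleton) auto

lemma measurable_block_iid: "block m j \<in> iid P \<rightarrow>\<^sub>M (\<Pi>\<^sub>M i\<in>{..<m}. P)"
  unfolding iid_def by (rule measurable_block) simp

lemma distr_block:
  assumes "prob_space P"
  shows "distr (iid P) (\<Pi>\<^sub>M i\<in>{..<m}. P) (block m j) = (\<Pi>\<^sub>M i\<in>{..<m}. P)"
  unfolding iid_def block_def
  by (rule distr_PiM_reindex) (use assms in \<open>auto simp: inj_on_def\<close>)

lemma indep_vars_coordinates:
  assumes "prob_space P"
  shows "prob_space.indep_vars (iid P) (\<lambda>_. P) (\<lambda>i \<omega>. \<omega> i) UNIV"
proof -
  interpret prob_space "iid P" using assms by (rule prob_space_iid)
  interpret coord: product_prob_space "\<lambda>_::nat. P" UNIV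
    using assms by (intro product_prob_spaceI)
  have "distr (iid P) P (\<lambda>\<omega>. \<omega> i) = P" for i
    using coord.PiM_component[of i] by (simp add: iid_def)
  then show ?thesis
    by (subst indep_vars_iff_distr_eq_PiM') (auto simp: iid_def distr_id2 restrict_UNIV)
qed

lemma indep_vars_blocks:
  assumes "prob_space P"
  shows "prob_space.indep_vars (iid P) (\<lambda>_. \<Pi>\<^sub>M i\<in>{..<m}. P) (\<lambda>j. block m j) UNIV"
proof -
  interpret prob_space "iid P" using assms by (rule prob_space_iid)
  define I where "I j = {j * m..<Suc j * m}" for j
  have "I i \<inter> I j = {}" if "i < j" for i j
  proof -
    have "Suc i * m \<le> j * m" using that by (intro mult_le_mono1) simp
    then show ?thesis by (auto simp: I_def)
  qed
  then have disj: "disjoint_family_on I UNIV"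
    unfolding disjoint_family_on_def by (metis Int_commute linorder_neqE_nat)
  have "indep_vars (\<lambda>j. \<Pi>\<^sub>M i\<in>I j. P) (\<lambda>j \<omega>. \<lambda>i\<in>I j. \<omega> i) UNIV"
    by (rule indep_vars_restrict[OF indep_vars_coordinates[OF assms] _ disj]) simp
  moreover have "block m j \<in> (\<Pi>\<^sub>M i\<in>I j. P) \<rightarrow>\<^sub>M (\<Pi>\<^sub>M i\<in>{..<m}. P)" for j
    by (rule measurable_block) (simp add: I_def)
  ultimately have "indep_vars (\<lambda>_. \<Pi>\<^sub>M i\<in>{..<m}. P)
      (\<lambda>j \<omega>. block m j (\<lambda>i\<in>I j. \<omega> i)) UNIV"
    by (rule indep_vars_compose2)
  moreover have "block m j (\<lambda>i\<in>I j. \<omega> i) = block m j \<omega>" for j and \<omega> :: "nat \<Rightarrow> 'a"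
    by (auto simp: block_def I_def fun_eq_iff)
  ultimately show ?thesis by simp
qed

lemma nn_integral_prod_blocks:
  fixes f :: "(nat \<Rightarrow> 'a) \<Rightarrow> ennreal"
  assumes P: "prob_space P" and f: "f \<in> borel_measurable (\<Pi>\<^sub>M i\<in>{..<m}. P)"
  shows "(\<integral>\<^sup>+\<omega>. (\<Prod>j<l. f (block m j \<omega>)) \<partial>iid P) = (\<integral>\<^sup>+\<omega>. f (obs m \<omega>) \<partial>iid P) ^ l"
proof -
  interpret prob_space "iid P" using P by (rule prob_space_iid)
  have E: "(\<integral>\<^sup>+\<omega>. f (block m j \<omega>) \<partial>iid P) = (\<integral>\<^sup>+x. f x \<partial>(\<Pi>\<^sub>M i\<in>{..<m}. P))" for j
    using nn_integral_distr[OF measurable_block_iid[of m j P], of f] f by (simp add: distr_block[OF P])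
  have "indep_vars (\<lambda>_. borel) (\<lambda>j \<omega>. f (block m j \<omega>)) {..<l}"
    by (rule indep_vars_compose2[OF indep_vars_subset[OF indep_vars_blocks[OF P]] f]) auto
  then have "(\<integral>\<^sup>+\<omega>. (\<Prod>j<l. f (block m j \<omega>)) \<partial>iid P)
      = (\<Prod>j<l. \<integral>\<^sup>+\<omega>. f (block m j \<omega>) \<partial>iid P)"
    by (intro indep_vars_nn_integral) auto
  then show ?thesis by (simp add: E obs_eq_block)
qed

section \<open>Majority decisions and their error probability\<close>

definition majority :: "((nat \<Rightarrow> 'a) \<Rightarrow> real) \<Rightarrow> nat \<Rightarrow> nat \<Rightarrow> (nat \<Rightarrow> 'a) \<Rightarrow> bool" where
  "majority a m l \<omega> \<longleftrightarrow> real l / 2 \<le> (\<Sum>j<l. a (block m j \<omega>))"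

lemma majority_obs:
  assumes "l * m \<le> n"
  shows "majority a m l (obs n \<omega>) = majority a m l \<omega>"
proof -
  have "block m j (obs n \<omega>) = block m j \<omega>" if "j < l" for j
  proof (rule block_obs)
    have "Suc j * m \<le> l * m" using that by (intro mult_le_mono1) simp
    then show "Suc j * m \<le> n" using assms by simp
  qed
  then show ?thesis by (simp add: majority_def)
qed

lemma measurable_majority:
  assumes a: "a \<in> borel_measurable (\<Pi>\<^sub>M i\<in>{..<m}. P)" and I: "{..<l * m} \<subseteq> I"
  shows "Measurable.pred (\<Pi>\<^sub>M i\<in>I. P) (majority a m l)"
proof -
  have [measurable]: "(\<lambda>\<omega>. a (block m j \<omega>)) \<in> borel_measurable (\<Pi>\<^sub>M i\<in>I. P)" if "j < l" for j
  proof (rule measurable_compose[OF measurable_block a])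
    have "Suc j * m \<le> l * m" using that by (intro mult_le_mono1) simp
    then show "{j * m..<Suc j * m} \<subseteq> I" using I by fastforce
  qed
  have [measurable]: "(\<lambda>\<omega>. \<Sum>j<l. a (block m j \<omega>)) \<in> borel_measurable (\<Pi>\<^sub>M i\<in>I. P)"
    by (intro borel_measurable_sum) simp
  show ?thesis unfolding majority_def by measurable
qed

text \<open>The convex function \<open>y \<mapsto> 4\<^sup>y\<close> lies below its chord over \<open>[0, 1]\<close>.\<close>

lemma four_powr_le_chord:
  fixes y :: real
  assumes "0 \<le> y" "y \<le> 1"
  shows "4 powr y \<le> 1 + 3 * y"
proof -
  have "exp ((1 - y) *\<^sub>R 0 + y *\<^sub>R ln 4) \<le> (1 - y) * exp 0 + y * exp (ln (4::real))"
    using assms by (intro convex_onD[OF exp_convex]) auto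
  then show ?thesis by (simp add: powr_def algebra_simps)
qed

text \<open>
  The Chernoff argument: \<open>4\<close> to the power \<open>\<Sum>(y\<^sub>j - 1/2)\<close> is at least \<open>1\<close>, and each factor
  \<open>4\<^bsup>y - 1/2\<^esup>\<close> is bounded by the affine function \<open>(1 + 3y)/2\<close>, so that only the expectation of
  \<open>y\<close> matters.
\<close>

lemma chernoff_pointwise:
  fixes y :: "nat \<Rightarrow> real"
  assumes y: "\<And>j. j < l \<Longrightarrow> 0 \<le> y j \<and> y j \<le> 1" and sum: "real l / 2 \<le> (\<Sum>j<l. y j)"
  shows "1 \<le> (\<Prod>j<l. (1 + 3 * y j) / 2)"
proof -
  have "4 powr (1 / 2) = (2::real)"
    using powr_half_sqrt[of 4] real_sqrt_abs[of 2] by simp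
  then have "(2::real) ^ l = 4 powr (real l / 2)"
    using powr_powr[of 4 "1/2" "real l"] by (simp add: powr_realpow)
  also have "\<dots> \<le> 4 powr (\<Sum>j<l. y j)" using sum by (intro powr_mono) simp_all
  also have "\<dots> = (\<Prod>j<l. 4 powr y j)" by (simp add: powr_sum)
  also have "\<dots> \<le> (\<Prod>j<l. 1 + 3 * y j)"
    by (intro prod_mono) (use y four_powr_le_chord in auto)
  finally show ?thesis by (simp add: prod_dividef field_simps)
qed

lemma majority_error_bound:
  assumes P: "prob_space P" and a: "a \<in> borel_measurable (\<Pi>\<^sub>M i\<in>{..<m}. P)"
    and a01: "\<And>x. x \<in> space (\<Pi>\<^sub>M i\<in>{..<m}. P) \<Longrightarrow> 0 \<le> a x \<and> a x \<le> 1"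
    and E: "expect P (\<lambda>\<omega>. a (obs m \<omega>)) \<le> ennreal (1 / 4)"
  shows "emeasure (iid P) {\<omega> \<in> space (iid P). majority a m l \<omega>} \<le> ennreal ((7 / 8) ^ l)"
proof -
  interpret prob_space "iid P" using P by (rule prob_space_iid)
  define f where "f x = ennreal ((1 + 3 * a x) / 2)" for x
  have f: "f \<in> borel_measurable (\<Pi>\<^sub>M i\<in>{..<m}. P)" unfolding f_def using a by measurable
  have a_block: "0 \<le> a (block m j \<omega>) \<and> a (block m j \<omega>) \<le> 1" if "\<omega> \<in> space (iid P)" for j \<omega>
    by (rule a01[OF measurable_space[OF measurable_block_iid that]])
  have a_obs [measurable]: "(\<lambda>\<omega>. a (obs m \<omega>)) \<in> borel_measurable (iid P)"
    unfolding obs_eq_block by (rule measurable_compose[OF measurable_block_iid a])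
  have maj [measurable]: "Measurable.pred (iid P) (majority a m l)"
    using measurable_majority[OF a] by (simp add: iid_def)

  have "(\<integral>\<^sup>+\<omega>. f (obs m \<omega>) \<partial>iid P) = (\<integral>\<^sup>+\<omega>. ennreal (1/2) + ennreal (3/2) * ennreal (a (obs m \<omega>)) \<partial>iid P)"
  proof (rule nn_integral_cong)
    fix \<omega> assume "\<omega> \<in> space (iid P)"
    then have nonneg: "0 \<le> a (obs m \<omega>)" using a_block[of \<omega> 0] by (simp add: obs_eq_block)
    have "f (obs m \<omega>) = ennreal (1/2 + 3/2 * a (obs m \<omega>))"
      unfolding f_def by (rule arg_cong[of _ _ ennreal]) (simp add: field_simps)
    also have "\<dots> = ennreal (1/2) + ennreal (3/2 * a (obs m \<omega>))"
      using nonneg by (intro ennreal_plus) auto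
    also have "ennreal (3/2 * a (obs m \<omega>)) = ennreal (3/2) * ennreal (a (obs m \<omega>))"
      using nonneg by (intro ennreal_mult) auto
    finally show "f (obs m \<omega>) = ennreal (1/2) + ennreal (3/2) * ennreal (a (obs m \<omega>))" .
  qed
  also have "\<dots> = ennreal (1/2) + ennreal (3/2) * expect P (\<lambda>\<omega>. a (obs m \<omega>))"
    by (simp add: nn_integral_add nn_integral_cmult emeasure_space_1 expect_def del: ennreal_half)
  also have "\<dots> \<le> ennreal (1/2) + ennreal (3/2) * ennreal (1/4)"
    by (intro add_mono mult_left_mono E) auto
  also have "\<dots> = ennreal (7/8)"
    by (simp add: ennreal_mult[symmetric] ennreal_plus[symmetric] del: ennreal_plus ennreal_half)
  finally have Ef: "(\<integral>\<^sup>+\<omega>. f (obs m \<omega>) \<partial>iid P) \<le> ennreal (7/8)" .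

  have "emeasure (iid P) {\<omega> \<in> space (iid P). majority a m l \<omega>}
      = (\<integral>\<^sup>+\<omega>. indicator {\<omega> \<in> space (iid P). majority a m l \<omega>} \<omega> \<partial>iid P)"
    by (rule nn_integral_indicator[symmetric]) measurable
  also have "\<dots> \<le> (\<integral>\<^sup>+\<omega>. (\<Prod>j<l. f (block m j \<omega>)) \<partial>iid P)"
  proof (rule nn_integral_mono)
    fix \<omega> assume \<omega>: "\<omega> \<in> space (iid P)"
    have "(\<Prod>j<l. f (block m j \<omega>)) = ennreal (\<Prod>j<l. (1 + 3 * a (block m j \<omega>)) / 2)"
      unfolding f_def by (rule prod_ennreal) (use a_block[OF \<omega>] in auto)
    moreover have "1 \<le> (\<Prod>j<l. (1 + 3 * a (block m j \<omega>)) / 2)" if "majority a m l \<omega>"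
      using that a_block[OF \<omega>] by (intro chernoff_pointwise) (auto simp: majority_def)
    ultimately show "indicator {\<omega> \<in> space (iid P). majority a m l \<omega>} \<omega> \<le> (\<Prod>j<l. f (block m j \<omega>))"
      by (auto split: split_indicator)
  qed
  also have "\<dots> = (\<integral>\<^sup>+\<omega>. f (obs m \<omega>) \<partial>iid P) ^ l"
    by (rule nn_integral_prod_blocks[OF P f])
  also have "\<dots> \<le> ennreal (7/8) ^ l" by (intro power_mono Ef) simp
  also have "\<dots> = ennreal ((7/8) ^ l)" by (rule ennreal_power) simp
  finally show ?thesis .
qed

text \<open>
  This reduces the error under the alternative to the error bound for the test \<open>1 - a\<close>. The converse
  implication fails at a tie, which counts as a majority for both tests.
\<close>

lemma majority_complement: "\<not> majority a m l \<omega> \<Longrightarrow> majority (\<lambda>x. 1 - a x) m l \<omega>"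
  by (simp add: majority_def sum_subtractf)

section \<open>The settling time of a sequence of decisions\<close>

text \<open>
  Only the decisions enter, never the law of the observations. On sequences whose decisions change
  infinitely often no number satisfies the condition, and the value is an unspecified constant; such
  sequences form a null set wherever the definition is applied.
\<close>

definition settling_time :: "(nat \<Rightarrow> 'b \<Rightarrow> bool) \<Rightarrow> 'b \<Rightarrow> nat" where
  "settling_time D \<omega> = (LEAST L. \<forall>l\<ge>L. D l \<omega> = D L \<omega>)"

lemma measurable_settling_time:
  assumes [measurable]: "\<And>l. Measurable.pred M (D l)"
  shows "settling_time D \<in> M \<rightarrow>\<^sub>M count_space UNIV"
  unfolding settling_time_def by measurable

lemma settling_time_eventually:
  assumes "\<forall>\<^sub>F l in sequentially. D l \<omega> = b"
  shows decision_after_settling_time: "settling_time D \<omega> \<le> l \<Longrightarrow> D l \<omega> = b"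
    and decision_before_settling_time: "settling_time D \<omega> = Suc k \<Longrightarrow> D k \<omega> \<noteq> b"
proof -
  let ?S = "\<lambda>L. \<forall>l\<ge>L. D l \<omega> = D L \<omega>"
  obtain L where L: "\<And>l. l \<ge> L \<Longrightarrow> D l \<omega> = b"
    using assms by (auto simp: eventually_sequentially)
  then have "?S L" by simp
  then have S: "?S (settling_time D \<omega>)" unfolding settling_time_def by (rule LeastI)
  have limit: "D (settling_time D \<omega>) \<omega> = b"
    using S[rule_format, of "max L (settling_time D \<omega>)"] L[of "max L (settling_time D \<omega>)"] by simp
  then show after: "D l \<omega> = b" if "settling_time D \<omega> \<le> l" for l
    using S[rule_format, OF that] limit by simp
  show "D k \<omega> \<noteq> b" if k: "settling_time D \<omega> = Suc k"
  proof
    assume "D k \<omega> = b"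
    then have "?S k" using after k by (metis le_antisym not_less_eq_eq)
    then have "settling_time D \<omega> \<le> k" unfolding settling_time_def by (rule Least_le)
    then show False using k by simp
  qed
qed

lemma eventually_decides:
  fixes q :: real
  assumes "prob_space M" and [measurable]: "\<And>l. Measurable.pred M (D l)"
    and q: "0 \<le> q" "q < 1"
    and bound: "\<And>l. emeasure M {\<omega> \<in> space M. D l \<omega> \<noteq> b} \<le> ennreal (q ^ l)"
  shows "AE \<omega> in M. \<forall>\<^sub>F l in sequentially. D l \<omega> = b"
proof -
  interpret prob_space M by fact
  have "summable (\<lambda>l. prob {\<omega> \<in> space M. D l \<omega> \<noteq> b})"
  proof (rule summable_comparison_test')
    show "summable (\<lambda>l. q ^ l)" using q by (intro summable_geometric) simp
    show "norm (prob {\<omega> \<in> space M. D l \<omega> \<noteq> b}) \<le> q ^ l" for l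
      using bound[of l] q by (simp add: emeasure_eq_measure)
  qed
  then have "AE \<omega> in M. \<forall>\<^sub>F l in sequentially. \<omega> \<in> space M - {\<omega> \<in> space M. D l \<omega> \<noteq> b}"
    by (intro borel_cantelli_AE1) (auto simp: less_top[symmetric])
  then show ?thesis
    by eventually_elim (auto elim: eventually_mono)
qed

text \<open>
  If \<open>T = Suc k\<close>, then \<open>r\<^bsup>T+1\<^esup>\<close> is the term with index \<open>k\<close> of the series \<open>\<Sum>l. r\<^bsup>l+2\<^esup> 1[wrong at l]\<close>;
  the summand \<open>r\<close> accounts for \<open>T = 0\<close>.
\<close>

lemma settling_time_exponential_moment:
  fixes q r :: real
  assumes "prob_space M" and D [measurable]: "\<And>l. Measurable.pred M (D l)"
    and q: "0 \<le> q" "q < 1" and r: "0 \<le> r" "r * q < 1"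
    and bound: "\<And>l. emeasure M {\<omega> \<in> space M. D l \<omega> \<noteq> b} \<le> ennreal (q ^ l)"
  shows "(\<integral>\<^sup>+\<omega>. ennreal (r ^ Suc (settling_time D \<omega>)) \<partial>M) \<le> ennreal (r + r\<^sup>2 / (1 - r * q))"
proof -
  interpret prob_space M by fact
  define W where "W l = {\<omega> \<in> space M. D l \<omega> \<noteq> b}" for l
  have W [measurable]: "W l \<in> sets M" for l unfolding W_def by measurable
  have "AE \<omega> in M. ennreal (r ^ Suc (settling_time D \<omega>))
      \<le> ennreal r + (\<Sum>l. ennreal (r ^ (l + 2)) * indicator (W l) \<omega>)"
    using eventually_decides[OF assms(1) D q bound] AE_space
  proof eventually_elim
    case (elim \<omega>)
    show ?case
    proof (cases "settling_time D \<omega>")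
      case 0
      then show ?thesis by simp
    next
      case (Suc k)
      have "\<omega> \<in> W k"
        using decision_before_settling_time[OF elim(1) Suc] elim(2) by (simp add: W_def)
      then have "ennreal (r ^ Suc (settling_time D \<omega>))
          = (\<Sum>l\<in>{k}. ennreal (r ^ (l + 2)) * indicator (W l) \<omega>)"
        using Suc by simp
      also have "\<dots> \<le> (\<Sum>l. ennreal (r ^ (l + 2)) * indicator (W l) \<omega>)"
        by (rule sum_le_suminf) auto
      finally show ?thesis by (simp add: add_increasing)
    qed
  qed
  then have "(\<integral>\<^sup>+\<omega>. ennreal (r ^ Suc (settling_time D \<omega>)) \<partial>M)
      \<le> (\<integral>\<^sup>+\<omega>. ennreal r + (\<Sum>l. ennreal (r ^ (l + 2)) * indicator (W l) \<omega>) \<partial>M)"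
    by (rule nn_integral_mono_AE)
  also have "\<dots> = ennreal r + (\<Sum>l. ennreal (r ^ (l + 2)) * emeasure M (W l))"
    by (simp add: nn_integral_add nn_integral_suminf nn_integral_cmult_indicator emeasure_space_1)
  also have "\<dots> \<le> ennreal r + (\<Sum>l. ennreal (r ^ (l + 2)) * ennreal (q ^ l))"
    by (intro add_mono order_refl suminf_le mult_left_mono) (use bound in \<open>auto simp: W_def\<close>)
  also have "(\<Sum>l. ennreal (r ^ (l + 2)) * ennreal (q ^ l)) = (\<Sum>l. ennreal (r\<^sup>2 * (r * q) ^ l))"
    using q r by (intro suminf_cong)
      (simp add: ennreal_mult[symmetric] power_mult_distrib power_add power2_eq_square mult_ac)
  also have "\<dots> = ennreal (r\<^sup>2 * (1 / (1 - r * q)))"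
    using q r by (intro suminf_ennreal_eq sums_mult geometric_sums) auto
  also have "ennreal r + \<dots> = ennreal (r + r\<^sup>2 / (1 - r * q))"
    using r by (simp add: ennreal_plus[symmetric] del: ennreal_plus)
  finally show ?thesis by simp
qed

section \<open>Uniform boundedness from a uniform exponential moment\<close>

lemma uniformly_bounded_if_exponential_moment:
  fixes t B :: real
  assumes t: "t > 0" and B: "0 \<le> B"
    and N: "\<And>P. P \<in> \<Theta>0 \<union> \<Theta>1 \<Longrightarrow> N \<in> borel_measurable (iid P)"
    and E: "\<And>P. P \<in> \<Theta>0 \<union> \<Theta>1 \<Longrightarrow> expect P (\<lambda>\<omega>. exp (t * N \<omega>)) \<le> ennreal B"
  shows "uniformly_bounded \<Theta>0 \<Theta>1 N"
proof -
  have tail: "emeasure (iid P) {\<omega> \<in> space (iid P). N \<omega> > c} \<le> ennreal (exp (- t * c) * B)"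
    if P: "P \<in> \<Theta>0 \<union> \<Theta>1" for P c
  proof -
    note [measurable] = N[OF P]
    have "emeasure (iid P) {\<omega> \<in> space (iid P). N \<omega> > c}
        \<le> (\<integral>\<^sup>+\<omega>. ennreal (exp (- t * c)) * ennreal (exp (t * N \<omega>)) \<partial>iid P)"
    proof (subst nn_integral_indicator[symmetric], measurable, rule nn_integral_mono)
      fix \<omega>
      have "1 \<le> exp (- t * c) * exp (t * N \<omega>)" if "N \<omega> > c"
        using that t by (simp add: exp_add[symmetric])
      then show "indicator {\<omega> \<in> space (iid P). c < N \<omega>} \<omega>
          \<le> ennreal (exp (- t * c)) * ennreal (exp (t * N \<omega>))"
        by (auto simp: ennreal_mult[symmetric] split: split_indicator)
    qed
    also have "\<dots> = ennreal (exp (- t * c)) * expect P (\<lambda>\<omega>. exp (t * N \<omega>))"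
      unfolding expect_def by (rule nn_integral_cmult) measurable
    also have "\<dots> \<le> ennreal (exp (- t * c)) * ennreal B"
      by (intro mult_left_mono E P) simp
    finally show ?thesis using B by (simp add: ennreal_mult)
  qed
  have "((\<lambda>c. exp (- t * c) * B) \<longlongrightarrow> 0 * B) at_top"
    using t by (intro tendsto_mult tendsto_const filterlim_compose[OF exp_at_bot]
        filterlim_tendsto_neg_mult_at_bot[OF tendsto_const] filterlim_ident) auto
  then have "((\<lambda>c. ennreal (exp (- t * c) * B)) \<longlongrightarrow> ennreal 0) at_top"
    by (intro tendsto_ennrealI) simp
  then have lim: "((\<lambda>c. ennreal (exp (- t * c) * B)) \<longlongrightarrow> 0) at_top"
    by simp
  show ?thesis
    unfolding uniformly_bounded_def
    by (rule tendsto_sandwich[OF _ _ tendsto_const lim])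
      (use tail in \<open>auto intro!: always_eventually SUP_least\<close>)
qed

section \<open>Uniform discernibility\<close>

lemma distinguishable_single_test:
  assumes "distinguishable \<Theta>0 \<Theta>1"
  obtains m a where "m \<ge> 1" "is_test m a"
    "\<And>P. P \<in> \<Theta>0 \<Longrightarrow> expect P (\<lambda>\<omega>. a (obs m \<omega>)) \<le> ennreal (1/4)"
    "\<And>P. P \<in> \<Theta>1 \<Longrightarrow> expect P (\<lambda>\<omega>. 1 - a (obs m \<omega>)) \<le> ennreal (1/4)"
proof -
  from assms[unfolded distinguishable_def, rule_format, of "1/4"]
  obtain K where K: "\<And>n. n \<ge> 1 \<Longrightarrow> is_test n (K n) \<and> err0 \<Theta>0 n (K n) < ennreal (1/4)"
    and lim: "(\<lambda>n. err1 \<Theta>1 n (K n)) \<longlonglongrightarrow> 0"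
    by auto
  have "\<forall>\<^sub>F n in sequentially. err1 \<Theta>1 n (K n) < ennreal (1/4)"
    by (rule order_tendstoD[OF lim]) (rule ennreal_less_zero_iff[THEN iffD2], simp)
  from eventually_conj[OF this eventually_ge_at_top[of "1::nat"]]
  obtain m where m: "err1 \<Theta>1 m (K m) < ennreal (1/4)" "m \<ge> 1"
    using eventually_happens by force
  show thesis
  proof (rule that[of m "K m"])
    show "expect P (\<lambda>\<omega>. K m (obs m \<omega>)) \<le> ennreal (1/4)" if "P \<in> \<Theta>0" for P
      using K[OF m(2)] SUP_upper[OF that, of "\<lambda>P. expect P (\<lambda>\<omega>. K m (obs m \<omega>))"]
      unfolding err0_def by (auto intro: order_trans less_imp_le)
    show "expect P (\<lambda>\<omega>. 1 - K m (obs m \<omega>)) \<le> ennreal (1/4)" if "P \<in> \<Theta>1" for P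
      using m(1) SUP_upper[OF that, of "\<lambda>P. expect P (\<lambda>\<omega>. 1 - K m (obs m \<omega>))"]
      unfolding err1_def by (auto intro: order_trans less_imp_le)
  qed (use m K in auto)
qed

theorem theorem2p6:
  fixes \<Theta>0 \<Theta>1 :: "'a::t2_space measure set"
  assumes "\<Theta>0 \<subseteq> all_laws" and "\<Theta>1 \<subseteq> all_laws"
    and "distinguishable \<Theta>0 \<Theta>1"
  shows "uniformly_discernible \<Theta>0 \<Theta>1 \<and>
    (\<exists>K N. uniformly_discerns \<Theta>0 \<Theta>1 K N \<and>
      (\<exists>t C :: real. t > 0 \<and>
        (SUP P\<in>\<Theta>0 \<union> \<Theta>1. expect P (\<lambda>\<omega>. exp (t * N \<omega>))) < ennreal C))"
proof -
  obtain m a where m: "m \<ge> 1" and a: "is_test m a"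
    and a0: "\<And>P. P \<in> \<Theta>0 \<Longrightarrow> expect P (\<lambda>\<omega>. a (obs m \<omega>)) \<le> ennreal (1/4)"
    and a1: "\<And>P. P \<in> \<Theta>1 \<Longrightarrow> expect P (\<lambda>\<omega>. 1 - a (obs m \<omega>)) \<le> ennreal (1/4)"
    using distinguishable_single_test[OF assms(3)] by metis
  define T where "T = settling_time (majority a m)"
  define N where "N \<omega> = real (m * Suc (T \<omega>))" for \<omega>
  define K where "K n \<omega> = (of_bool (majority a m (n div m) \<omega>) :: real)" for n \<omega>
  \<comment> \<open>Any \<open>r > 1\<close> with \<open>7r/8 < 1\<close> would do; this one makes \<open>7r/8 = 15/16\<close>.\<close>
  define r :: real where "r = 15/14"
  define t where "t = ln r / m"
  have t: "t > 0" using m by (simp add: t_def r_def)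
  have exp_N: "exp (t * N \<omega>) = r ^ Suc (T \<omega>)" for \<omega>
  proof -
    have "t * N \<omega> = real (Suc (T \<omega>)) * ln r" using m by (simp add: t_def N_def field_simps)
    then show ?thesis by (simp only: exp_of_nat_mult) (simp add: r_def)
  qed

  have a_borel: "a \<in> borel_measurable (\<Pi>\<^sub>M i\<in>{..<m}. borel)"
    using a by (simp add: is_test_def)
  have K_test: "is_test n (K n)" for n
  proof -
    have "{..<n div m * m} \<subseteq> {..<n}" by auto
    note measurable_majority[OF a_borel this, measurable]
    show ?thesis unfolding is_test_def K_def by (auto simp: of_bool_def)
  qed
  have T: "T \<in> (\<Pi>\<^sub>M i\<in>UNIV. borel) \<rightarrow>\<^sub>M count_space UNIV"
    unfolding T_def by (intro measurable_settling_time measurable_majority[OF a_borel]) simp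
  have N_borel: "N \<in> borel_measurable (\<Pi>\<^sub>M i\<in>UNIV. borel)"
    unfolding N_def using T by measurable
  have N_pos: "0 < N \<omega>" for \<omega>
    using m unfolding N_def of_nat_0_less_iff by simp
  have K_obs: "K n (obs n \<omega>) = of_bool (majority a m (n div m) \<omega>)" for n \<omega>
    by (simp add: K_def majority_obs)

  \<comment> \<open>Everything that the theorem claims for a single law \<open>P\<close>, whose correct decision is \<open>b\<close>.\<close>
  have law: "expect P (\<lambda>\<omega>. exp (t * N \<omega>)) \<le> ennreal (r + r\<^sup>2 / (1 - r * (7/8))) \<and>
      \<P>(\<omega> in iid P. \<forall>n. real n > N \<omega> \<longrightarrow> K n (obs n \<omega>) = of_bool b) = 1"
    if P: "P \<in> all_laws"
      and wrong: "\<And>l. emeasure (iid P) {\<omega> \<in> space (iid P). majority a m l \<omega> \<noteq> b} \<le> ennreal ((7/8) ^ l)"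
    for P b
  proof
    have prob: "prob_space P" and sets: "sets P = sets borel" using P by (auto simp: all_laws_iff)
    interpret prob_space "iid P" using prob by (rule prob_space_iid)
    note meas_eq = measurable_cong_sets[OF sets_iid_cong[OF sets] refl]
    have D [measurable]: "Measurable.pred (iid P) (majority a m l)" for l
      using measurable_majority[OF a_borel] by (simp add: meas_eq)
    have [measurable]: "N \<in> borel_measurable (iid P)" using N_borel by (simp add: meas_eq)
    show "expect P (\<lambda>\<omega>. exp (t * N \<omega>)) \<le> ennreal (r + r\<^sup>2 / (1 - r * (7/8)))"
      unfolding expect_def exp_N T_def
      by (rule settling_time_exponential_moment[OF prob_space_axioms D _ _ _ _ wrong])
        (auto simp: r_def)
    have "AE \<omega> in iid P. \<forall>\<^sub>F l in sequentially. majority a m l \<omega> = b"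
      by (rule eventually_decides[OF prob_space_axioms D _ _ wrong]) auto
    then have "AE \<omega> in iid P. \<forall>n. real n > N \<omega> \<longrightarrow> K n (obs n \<omega>) = of_bool b"
    proof eventually_elim
      case (elim \<omega>)
      have "K n (obs n \<omega>) = of_bool b" if "real n > N \<omega>" for n
      proof -
        have "m * T \<omega> \<le> n" using that unfolding N_def of_nat_less_iff by simp
        then have "T \<omega> \<le> n div m" using m by (simp add: less_eq_div_iff_mult_less_eq mult.commute)
        then show ?thesis
          using decision_after_settling_time[where D = "majority a m", OF elim] by (simp add: K_obs T_def)
      qed
      then show ?case by blast
    qed
    moreover have "{\<omega> \<in> space (iid P). \<forall>n. real n > N \<omega> \<longrightarrow> K n (obs n \<omega>) = of_bool b} \<in> sets (iid P)"
      unfolding K_obs by measurable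
    ultimately show "\<P>(\<omega> in iid P. \<forall>n. real n > N \<omega> \<longrightarrow> K n (obs n \<omega>) = of_bool b) = 1"
      by (subst prob_Collect_eq_1)
  qed

  have borel_facts: "prob_space P" "a \<in> borel_measurable (\<Pi>\<^sub>M i\<in>{..<m}. P)"
      "\<And>x. x \<in> space (\<Pi>\<^sub>M i\<in>{..<m}. P) \<Longrightarrow> 0 \<le> a x \<and> a x \<le> 1"
    if "P \<in> all_laws" for P
  proof -
    have sets: "sets P = sets borel" using that by (simp add: all_laws_iff)
    then have sets': "sets (\<Pi>\<^sub>M i\<in>{..<m}. P) = sets (\<Pi>\<^sub>M i\<in>{..<m}. borel)"
      by (intro sets_PiM_cong) auto
    show "prob_space P" using that by (simp add: all_laws_iff)
    show "a \<in> borel_measurable (\<Pi>\<^sub>M i\<in>{..<m}. P)"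
      using a_borel by (simp add: measurable_cong_sets[OF sets' refl])
    show "0 \<le> a x \<and> a x \<le> 1" if "x \<in> space (\<Pi>\<^sub>M i\<in>{..<m}. P)" for x
      using a that by (auto simp: is_test_def sets_eq_imp_space_eq[OF sets'])
  qed
  have law0: "expect P (\<lambda>\<omega>. exp (t * N \<omega>)) \<le> ennreal (r + r\<^sup>2 / (1 - r * (7/8))) \<and>
      \<P>(\<omega> in iid P. \<forall>n. real n > N \<omega> \<longrightarrow> K n (obs n \<omega>) = of_bool False) = 1"
    if P: "P \<in> \<Theta>0" for P
  proof (rule law)
    show P': "P \<in> all_laws" using P assms(1) by auto
    show "emeasure (iid P) {\<omega> \<in> space (iid P). majority a m l \<omega> \<noteq> False} \<le> ennreal ((7/8) ^ l)" for l
      using majority_error_bound[OF borel_facts[OF P'] a0[OF P]] by simp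
  qed
  have law1: "expect P (\<lambda>\<omega>. exp (t * N \<omega>)) \<le> ennreal (r + r\<^sup>2 / (1 - r * (7/8))) \<and>
      \<P>(\<omega> in iid P. \<forall>n. real n > N \<omega> \<longrightarrow> K n (obs n \<omega>) = of_bool True) = 1"
    if P: "P \<in> \<Theta>1" for P
  proof (rule law)
    show P': "P \<in> all_laws" using P assms(2) by auto
    note facts = borel_facts[OF P']
    let ?a' = "\<lambda>x. 1 - a x"
    have a': "?a' \<in> borel_measurable (\<Pi>\<^sub>M i\<in>{..<m}. P)" using facts(2) by measurable
    show "emeasure (iid P) {\<omega> \<in> space (iid P). majority a m l \<omega> \<noteq> True} \<le> ennreal ((7/8) ^ l)" for l
    proof (rule order_trans[OF emeasure_mono])
      show "{\<omega> \<in> space (iid P). majority a m l \<omega> \<noteq> True}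
          \<subseteq> {\<omega> \<in> space (iid P). majority ?a' m l \<omega>}"
        using majority_complement by auto
      show "{\<omega> \<in> space (iid P). majority ?a' m l \<omega>} \<in> sets (iid P)"
        using measurable_majority[OF a', of l UNIV] by (auto simp: iid_def pred_def)
      show "emeasure (iid P) {\<omega> \<in> space (iid P). majority ?a' m l \<omega>} \<le> ennreal ((7/8) ^ l)"
        by (rule majority_error_bound[OF facts(1) a' _ a1[OF P]]) (use facts(3) in auto)
    qed
  qed
  have E: "expect P (\<lambda>\<omega>. exp (t * N \<omega>)) \<le> ennreal (r + r\<^sup>2 / (1 - r * (7/8)))"
    if "P \<in> \<Theta>0 \<union> \<Theta>1" for P
    using that law0 law1 by blast
  have bounded: "uniformly_bounded \<Theta>0 \<Theta>1 N"
  proof (rule uniformly_bounded_if_exponential_moment[OF t _ _ E])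
    show "N \<in> borel_measurable (iid P)" if "P \<in> \<Theta>0 \<union> \<Theta>1" for P
    proof -
      have "sets P = sets borel" using that assms(1,2) by (auto simp: all_laws_iff)
      then show ?thesis
        using N_borel by (simp add: measurable_cong_sets[OF sets_iid_cong refl])
    qed
  qed (simp add: r_def)
  have discerns: "uniformly_discerns \<Theta>0 \<Theta>1 K N"
    unfolding uniformly_discerns_def positive_rv_def
    using K_test N_borel N_pos bounded law0 law1 by simp
  have "(SUP P\<in>\<Theta>0 \<union> \<Theta>1. expect P (\<lambda>\<omega>. exp (t * N \<omega>))) \<le> ennreal (r + r\<^sup>2 / (1 - r * (7/8)))"
    by (intro SUP_least E)
  also have "\<dots> < ennreal 20"
    by (subst ennreal_less_iff) (simp_all add: r_def power2_eq_square)
  finally show ?thesis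
    using discerns t unfolding uniformly_discernible_def by blast
qed

end
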